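(* Let $W$ be a finite-dimensional vector space with norm $\|\cdot\|_W$ and let $V,X\subset W$ with $V\oplus X=W$, so that every $w\in W$ can be written uniquely as $w=v+x$ with $v\in V$ and $x\in X$. Let $\mathcal{B}:W\times W\to\mathbb{R}$ be a (possibly non-linear) operator such that: (i) (coercivity) there exists $\Lambda_W>0$ with $\mathcal{B}(w,w)\ge\Lambda_W\|w\|_W^2$ for all $w\in W$; (ii) (continuity in the first argument) if $\lim_{i\to\infty}w_i=w\in W$, then $\lim_{i\to\infty}\mathcal{B}(w_i,v)=\mathcal{B}(w,v)$ for all $v\in V$. Let $\mathcal{S}:W\times W\to\mathbb{R}$ be another operator, whose support is restricted to $X\times X$ in the sense that $$\mathcal{S}(v,\hat v)=0\quad\text{for all } v,\hat v\in V,\qquad \mathcal{S}(v,x)=\mathcal{S}(x,v)=0\quad\text{for all } v\in V,\ x\in X,$$ and which is coercive on $X$: there exists $\Lambda_X>0$ with $\mathcal{S}(x,x)\ge\Lambda_X\|x\|_X^2$ for all $x\in X$, where $\|\cdot\|_X$ is a norm on $X$. For $0\le\sigma\in\mathbb{R}$ define the super-penalised form $\mathcal{B}_\sigma:=\mathcal{B}+\sigma\mathcal{S}$. Let $\ell\in W^*$ be independent of $\sigma$. Choose $w_\sigma\in W$ such that $$\mathcal{B}_\sigma(w_\sigma,w)=\ell(w)\qquad\text{for all } w\in W,$$ and choose $v_h\in V$ such that $$\mathcal{B}(v_h,v)=\ell(v)\qquad\text{for all } v\in V.$$ Then $$\lim_{\sigma\to\infty}(w_\sigma-v_h)=0.$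$
   Context: $W^*$ denotes the dual space of $W$. The constants $\Lambda_W$, $\Lambda_X$ and the dual norm $\|\ell\|_{W^*}$ are independent of $\sigma$ ($\Lambda_W$ is typically also independent of the dimension of $W$). Convergence is in the finite-dimensional normed space $W$.
   Formalization: The solution v_h of the problem on V is assumed unique (automatic for bilinear B), and S is assumed to depend only on X-components, S(v+x,v'+x')=S(x,x') (automatic for bilinear S); without these the claim fails for non-linear B or S. *)

theory Defs
  imports "HOL-Analysis.Analysis"
begin

definition direct_sum_decomposition :: "'w::real_vector set \<Rightarrow> 'w set \<Rightarrow> bool" where
  "direct_sum_decomposition V X \<longleftrightarrow>
     subspace V \<and> subspace X \<and>
     (\<forall>w. \<exists>!p. fst p \<in> V \<and> snd p \<in> X \<and> w = fst p + snd p)"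

definition norm_on :: "'w::real_vector set \<Rightarrow> ('w \<Rightarrow> real) \<Rightarrow> bool" where
  "norm_on X N \<longleftrightarrow>
     (\<forall>x\<in>X. 0 \<le> N x) \<and>
     (\<forall>x\<in>X. N x = 0 \<longleftrightarrow> x = 0) \<and>
     (\<forall>c. \<forall>x\<in>X. N (c *\<^sub>R x) = \<bar>c\<bar> * N x) \<and>
     (\<forall>x\<in>X. \<forall>y\<in>X. N (x + y) \<le> N x + N y)"

(* The form S is not assumed to be linear. For a nonlinear S the vanishing conditions in the first
   three lines say nothing about arguments outside V and X; the last line, that S only
   sees the X-components of its arguments, is what restricting the support to X \<times> X means
   there. For a biadditive S it follows from the vanishing conditions (next lemma). *)
definition support_restricted ::
  "'w::real_vector set \<Rightarrow> 'w set \<Rightarrow> ('w \<Rightarrow> 'w \<Rightarrow> real) \<Rightarrow> bool" where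
  "support_restricted V X S \<longleftrightarrow>
     (\<forall>v\<in>V. \<forall>v'\<in>V. S v v' = 0) \<and>
     (\<forall>v\<in>V. \<forall>x\<in>X. S v x = 0) \<and>
     (\<forall>v\<in>V. \<forall>x\<in>X. S x v = 0) \<and>
     (\<forall>v\<in>V. \<forall>x\<in>X. \<forall>v'\<in>V. \<forall>x'\<in>X. S (v + x) (v' + x') = S x x')"

lemma support_restricted_biadditive:
  assumes "\<And>a b c. S (a + b) c = S a c + S b c" "\<And>a b c. S a (b + c) = S a b + S a c"
    and "\<forall>v\<in>V. \<forall>v'\<in>V. S v v' = 0" "\<forall>v\<in>V. \<forall>x\<in>X. S v x = 0" "\<forall>v\<in>V. \<forall>x\<in>X. S x v = 0"
  shows "support_restricted V X S"
  using assms by (simp add: support_restricted_def)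

definition solves_on ::
  "'w set \<Rightarrow> ('w \<Rightarrow> 'w \<Rightarrow> real) \<Rightarrow> ('w::real_normed_vector \<Rightarrow>\<^sub>L real) \<Rightarrow> 'w \<Rightarrow> bool" where
  "solves_on U B l u \<longleftrightarrow> u \<in> U \<and> (\<forall>z\<in>U. B u z = blinfun_apply l z)"

(* Coercivity makes the solution on a subspace unique when B is bilinear, but not for nonlinear B:
   on the real line, B w z = (w^3 - 4 * w^2 + 5 * w) * z satisfies B w w >= w^2, while both
   w = 1 and w = 2 solve B w z = 2 * z for all z. *)
lemma solves_on_unique_bilinear:
  assumes "bilinear B" "0 < L" "\<forall>w. B w w \<ge> L * (norm w)\<^sup>2" "subspace U"
    and "solves_on U B l u" "solves_on U B l u'"
  shows "u = u'"
proof -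
  have "u - u' \<in> U" using assms by (auto simp: solves_on_def subspace_diff)
  then have "B (u - u') (u - u') = 0"
    using assms by (auto simp: solves_on_def bilinear_lsub)
  then have "L * (norm (u - u'))\<^sup>2 \<le> 0" using assms(3) by metis
  then show ?thesis using assms(2) by (simp add: mult_le_0_iff)
qed

end

theory Submission
  imports Defs
begin

text \<open>
  The proof is a compactness argument. Write \<open>w \<sigma> = v \<sigma> + x \<sigma>\<close> along \<open>W = V \<oplus> X\<close>.
  Testing the penalised equation with its own solution and using that the penalty is nonnegative
  on the diagonal, coercivity of \<open>B\<close> bounds \<open>w \<sigma>\<close> uniformly in \<open>\<sigma>\<close>. The same
  test then bounds \<open>\<sigma> * S (x \<sigma>) (x \<sigma>)\<close>, so \<open>NX (x \<sigma>)\<close> tends to zero: every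
  accumulation point of \<open>w \<sigma>\<close> for \<open>\<sigma> \<rightarrow> \<infinity>\<close> lies in \<open>V\<close>. Testing with
  elements of \<open>V\<close> makes the penalty vanish, and continuity of \<open>B\<close> in the first argument
  shows that such an accumulation point solves the problem on \<open>V\<close>, hence equals \<open>vh\<close>. As
  bounded sequences have convergent subsequences, a sequence that stayed away from \<open>vh\<close> would
  have another accumulation point, which is impossible.

  Two facts on finite-dimensional normed spaces enter: bounded sequences have convergent
  subsequences (\<open>bounded_seq_in_finite_span\<close>), and every seminorm is dominated by the norm
  (\<open>seminorm_le_norm_on_finite_span\<close>). The second is applied to
  \<open>u \<mapsto> NX (X-component of u)\<close>, a seminorm with kernel \<open>V\<close>; its continuity is what carries
  \<open>NX (x \<sigma>) \<rightarrow> 0\<close> over to the accumulation point. Both facts follow by induction on the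
  spanning set.
\<close>

section \<open>Finite-dimensional normed spaces\<close>

text \<open>
  The coefficient of a vector outside a closed subspace is controlled by the norm because that
  vector has positive distance from the subspace. This is the induction step of both facts below.
\<close>

lemma coefficient_bound_closed_subspace:
  fixes a :: "'a::real_normed_vector"
  assumes "subspace T" "closed T" "a \<notin> T"
  obtains d where "d > 0" "\<And>c z. z - c *\<^sub>R a \<in> T \<Longrightarrow> \<bar>c\<bar> * d \<le> norm z"
proof -
  have "\<exists>d>0. \<forall>y\<in>T. d \<le> dist a y"
    using infdist_pos_not_in_closed[of T a] assms subspace_0[OF assms(1)]
    by (metis empty_iff infdist_le)
  then obtain d where d: "d > 0" "\<forall>y\<in>T. d \<le> dist a y" by blast
  have "\<bar>c\<bar> * d \<le> norm z" if z: "z - c *\<^sub>R a \<in> T" for c z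
  proof (cases "c = 0")
    case False
    have "(-1/c) *\<^sub>R (z - c *\<^sub>R a) \<in> T" using z assms(1) subspace_scale by blast
    then have "d \<le> norm (a - (-1/c) *\<^sub>R (z - c *\<^sub>R a))"
      using d(2) by (simp only: dist_norm[symmetric])
    also have "a - (-1/c) *\<^sub>R (z - c *\<^sub>R a) = (1/c) *\<^sub>R z"
      using False by (simp add: algebra_simps)
    finally have "d \<le> norm z / \<bar>c\<bar>" by simp
    then show ?thesis using False by (simp add: field_simps)
  qed simp
  with d(1) that show thesis by blast
qed

lemma closed_if_bounded_seqs_subconverge:
  fixes T :: "'a::real_normed_vector set"
  assumes "\<And>u. (\<And>n. u n \<in> T) \<Longrightarrow> bounded (range u) \<Longrightarrow>
      \<exists>l\<in>T. \<exists>r::nat \<Rightarrow> nat. strict_mono r \<and> (u \<circ> r) \<longlonglongrightarrow> l"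
  shows "closed T"
  unfolding closed_sequential_limits
proof (intro allI impI, elim conjE)
  fix u :: "nat \<Rightarrow> 'a" and l assume u: "\<forall>n. u n \<in> T" "u \<longlonglongrightarrow> l"
  then obtain l' r where l': "l' \<in> T" "strict_mono (r::nat \<Rightarrow> nat)" "(u \<circ> r) \<longlonglongrightarrow> l'"
    using assms[of u] convergent_imp_bounded[OF u(2)] by blast
  have "(u \<circ> r) \<longlonglongrightarrow> l" using u(2) l'(2) by (rule LIMSEQ_subseq_LIMSEQ)
  then show "l \<in> T" using l' LIMSEQ_unique by blast
qed

text \<open>
  Bolzano--Weierstrass without a Euclidean structure. If the new vector \<open>a\<close> lies outside the
  closed subspace \<open>span A\<close>, the coefficients of \<open>a\<close> stay bounded; passing to a subsequence
  along which they converge reduces the claim to \<open>span A\<close>.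
\<close>

lemma bounded_seq_in_finite_span:
  fixes u :: "nat \<Rightarrow> 'a::real_normed_vector"
  assumes "finite A" "\<And>n. u n \<in> span A" "bounded (range u)"
  shows "\<exists>l\<in>span A. \<exists>r::nat \<Rightarrow> nat. strict_mono r \<and> (u \<circ> r) \<longlonglongrightarrow> l"
  using assms
proof (induction A arbitrary: u rule: finite_induct)
  case empty
  then have "u = (\<lambda>_. 0)" by auto
  then show ?case by (auto intro!: exI[of _ id] simp: strict_mono_id o_def)
next
  case (insert a A)
  show ?case
  proof (cases "a \<in> span A")
    case True
    then show ?thesis using insert by (simp add: span_redundant)
  next
    case False
    have "closed (span A)"
      using insert.IH by (rule closed_if_bounded_seqs_subconverge)
    then obtain d where d: "d > 0"
      "\<And>c z. z - c *\<^sub>R a \<in> span A \<Longrightarrow> \<bar>c\<bar> * d \<le> norm z"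
      using coefficient_bound_closed_subspace[OF subspace_span _ False] by metis
    obtain M where M: "\<And>n. norm (u n) \<le> M"
      using insert.prems(2) by (auto simp: bounded_iff)
    have "\<forall>n. \<exists>k. u n - k *\<^sub>R a \<in> span A"
      using insert.prems(1) by (simp add: span_breakdown_eq)
    then obtain c where c: "\<And>n. u n - c n *\<^sub>R a \<in> span A" by metis
    have cb: "\<bar>c n\<bar> \<le> M / d" for n
      using d(2)[OF c, of n] M[of n] d(1) by (simp add: field_simps)
    then have "bounded (range c)" by (auto simp: bounded_iff)
    then obtain c0 r where r: "strict_mono (r::nat \<Rightarrow> nat)" "(c \<circ> r) \<longlonglongrightarrow> c0"
      using bounded_imp_convergent_subsequence by blast
    define y where "y n = u (r n) - c (r n) *\<^sub>R a" for n
    have "norm (y n) \<le> M + M / d * norm a" for n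
    proof -
      have "norm (y n) \<le> norm (u (r n)) + norm (c (r n) *\<^sub>R a)"
        unfolding y_def by (rule norm_triangle_ineq4)
      then show ?thesis
        using M[of "r n"] mult_right_mono[OF cb[of "r n"] norm_ge_zero[of a]] by simp
    qed
    then have "bounded (range y)" by (auto simp: bounded_iff)
    moreover have "y n \<in> span A" for n using c by (simp add: y_def)
    ultimately obtain l s where l: "l \<in> span A" "strict_mono (s::nat \<Rightarrow> nat)" "(y \<circ> s) \<longlonglongrightarrow> l"
      using insert.IH[of y] by blast
    have "((c \<circ> r) \<circ> s) \<longlonglongrightarrow> c0" using r(2) l(2) by (rule LIMSEQ_subseq_LIMSEQ)
    then have "(\<lambda>n. (y \<circ> s) n + ((c \<circ> r) \<circ> s) n *\<^sub>R a) \<longlonglongrightarrow> l + c0 *\<^sub>R a"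
      by (intro tendsto_intros l(3))
    moreover have "(\<lambda>n. (y \<circ> s) n + ((c \<circ> r) \<circ> s) n *\<^sub>R a) = u \<circ> (r \<circ> s)"
      by (simp add: y_def o_def)
    moreover have "l + c0 *\<^sub>R a \<in> span (insert a A)"
      using l(1) by (auto simp: span_breakdown_eq intro!: exI[of _ c0])
    ultimately show ?thesis using strict_mono_o[OF r(1) l(2)] by metis
  qed
qed

lemma closed_finite_span:
  fixes A :: "'a::real_normed_vector set"
  assumes "finite A"
  shows "closed (span A)"
  using bounded_seq_in_finite_span[OF assms] by (rule closed_if_bounded_seqs_subconverge)

text \<open>
  In the decomposition \<open>z = c *\<^sub>R a + y\<close> both \<open>\<bar>c\<bar>\<close> and \<open>norm y\<close> are at most a multiple
  of \<open>norm z\<close>, so subadditivity passes the estimate from \<open>span A\<close> to \<open>span (insert a A)\<close>.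
\<close>

lemma seminorm_le_norm_on_finite_span:
  fixes p :: "'a::real_normed_vector \<Rightarrow> real"
  assumes "finite A"
    and tri: "\<And>x y. p (x + y) \<le> p x + p y"
    and hom: "\<And>c x. p (c *\<^sub>R x) = \<bar>c\<bar> * p x"
    and nonneg: "\<And>x. 0 \<le> p x"
  shows "\<exists>C\<ge>0. \<forall>z\<in>span A. p z \<le> C * norm z"
  using \<open>finite A\<close>
proof (induction A rule: finite_induct)
  case empty
  then show ?case using hom[of 0 0] by auto
next
  case (insert a A)
  then obtain C where C: "C \<ge> 0" "\<And>z. z \<in> span A \<Longrightarrow> p z \<le> C * norm z" by blast
  show ?case
  proof (cases "a \<in> span A")
    case True
    then show ?thesis using C by (auto simp: span_redundant)
  next
    case False
    then obtain d where d: "d > 0"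
      "\<And>c z. z - c *\<^sub>R a \<in> span A \<Longrightarrow> \<bar>c\<bar> * d \<le> norm z"
      using coefficient_bound_closed_subspace[OF subspace_span closed_finite_span[OF insert.hyps(1)]]
      by metis
    define K where "K = p a / d + C * (1 + norm a / d)"
    have "p z \<le> K * norm z" if z: "z \<in> span (insert a A)" for z
    proof -
      obtain c where c: "z - c *\<^sub>R a \<in> span A"
        using z unfolding span_breakdown_eq by blast
      have cd: "\<bar>c\<bar> \<le> norm z / d" using d(2)[OF c] d(1) by (simp add: field_simps)
      have "p z \<le> p (c *\<^sub>R a) + p (z - c *\<^sub>R a)" using tri[of "c *\<^sub>R a" "z - c *\<^sub>R a"] by simp
      also have "\<dots> \<le> \<bar>c\<bar> * p a + C * norm (z - c *\<^sub>R a)" using C(2)[OF c] hom by simp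
      also have "\<dots> \<le> \<bar>c\<bar> * p a + C * (norm z + \<bar>c\<bar> * norm a)"
        using norm_triangle_ineq4[of z "c *\<^sub>R a"] C(1) by (simp add: mult_left_mono)
      also have "\<dots> \<le> norm z / d * p a + C * (norm z + norm z / d * norm a)"
        by (intro add_mono mult_left_mono mult_right_mono cd nonneg norm_ge_zero C(1) order_refl)
      also have "\<dots> = K * norm z" by (simp add: K_def algebra_simps)
      finally show ?thesis .
    qed
    moreover have "K \<ge> 0" using C(1) d(1) nonneg[of a] by (simp add: K_def)
    ultimately show ?thesis by blast
  qed
qed

section \<open>Limit of the super-penalised solutions\<close>

text \<open>The projection onto \<open>X\<close> along \<open>V\<close>; its linearity is the uniqueness of the decomposition.\<close>

lemma direct_sum_projection:
  assumes "direct_sum_decomposition V X"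
  obtains P where "linear P" "\<And>u. P u \<in> X" "\<And>u. u - P u \<in> V"
proof -
  have V: "subspace V" and X: "subspace X"
    and ex: "\<forall>u. \<exists>!p. fst p \<in> V \<and> snd p \<in> X \<and> u = fst p + snd p"
    using assms by (auto simp: direct_sum_decomposition_def)
  have "\<forall>u. \<exists>x. x \<in> X \<and> u - x \<in> V"
  proof
    fix u
    obtain q where "fst q \<in> V" "snd q \<in> X" "u = fst q + snd q" using ex by blast
    then show "\<exists>x. x \<in> X \<and> u - x \<in> V" by (intro exI[of _ "snd q"]) auto
  qed
  then obtain P where P: "\<And>u. P u \<in> X" "\<And>u. u - P u \<in> V" by metis
  have uniq: "P u = x" if "x \<in> X" "u - x \<in> V" for u x
  proof -
    have "(u - P u, P u) = (u - x, x)"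
      using ex[rule_format, of u] P[of u] that
      by (elim ex1E) (metis diff_add_cancel fst_conv snd_conv)
    then show ?thesis by simp
  qed
  have "linear P"
  proof (rule linearI)
    fix x y
    have "(x - P x) + (y - P y) \<in> V" using P V subspace_add by blast
    then show "P (x + y) = P x + P y"
      using P X by (intro uniq) (auto simp: subspace_add algebra_simps)
  next
    fix c x
    have "c *\<^sub>R (x - P x) \<in> V" using P V subspace_scale by blast
    then show "P (c *\<^sub>R x) = c *\<^sub>R P x"
      using P X by (intro uniq) (auto simp: subspace_scale algebra_simps)
  qed
  with P that show thesis by blast
qed

theorem mainTheorem1:
  fixes V X :: "'w::real_normed_vector set"
    and B S :: "'w \<Rightarrow> 'w \<Rightarrow> real"
    and NX :: "'w \<Rightarrow> real"
    and l :: "'w \<Rightarrow>\<^sub>L real"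
    and w :: "real \<Rightarrow> 'w"
    and vh :: 'w
  assumes finite_dim: "\<exists>A :: 'w set. finite A \<and> span A = UNIV"
    and decomposition: "direct_sum_decomposition V X"
    and coercive_B: "\<exists>\<Lambda>\<^sub>W>0. \<forall>u. B u u \<ge> \<Lambda>\<^sub>W * (norm u)\<^sup>2"
    and continuous_B: "\<And>(u :: nat \<Rightarrow> 'w) u\<^sub>0. u \<longlonglongrightarrow> u\<^sub>0 \<Longrightarrow> (\<forall>v\<in>V. (\<lambda>i. B (u i) v) \<longlonglongrightarrow> B u\<^sub>0 v)"
    and support_S: "support_restricted V X S"
    and norm_X: "norm_on X NX"
    and coercive_S: "\<exists>\<Lambda>\<^sub>X>0. \<forall>x\<in>X. S x x \<ge> \<Lambda>\<^sub>X * (NX x)\<^sup>2"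
    and w_solution: "\<And>\<sigma>. 0 \<le> \<sigma> \<Longrightarrow> solves_on UNIV (\<lambda>u z. B u z + \<sigma> * S u z) l (w \<sigma>)"
    and vh_solution: "solves_on V B l vh"
    and vh_unique: "\<And>v. solves_on V B l v \<Longrightarrow> v = vh"
  shows "((\<lambda>\<sigma>. w \<sigma> - vh) \<longlongrightarrow> 0) at_top"
proof -
  obtain A :: "'w set" where A: "finite A" "span A = UNIV" using finite_dim by blast
  obtain L where L: "L > 0" "\<And>u. B u u \<ge> L * (norm u)\<^sup>2" using coercive_B by blast
  obtain K where K: "K > 0" "\<And>x. x \<in> X \<Longrightarrow> S x x \<ge> K * (NX x)\<^sup>2" using coercive_S by blast
  have V: "subspace V" and X: "subspace X"
    using decomposition by (auto simp: direct_sum_decomposition_def)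
  obtain P where P: "linear P" "\<And>u. P u \<in> X" "\<And>u. u - P u \<in> V"
    using direct_sum_projection[OF decomposition] by blast
  have S_proj: "S u u' = S (P u) (P u')" for u u'
  proof -
    have "S ((u - P u) + P u) ((u' - P u') + P u') = S (P u) (P u')"
      using support_S P(2,3) unfolding support_restricted_def by blast
    then show ?thesis by simp
  qed
  have S_V: "S u v = 0" if "v \<in> V" for u v
  proof -
    have "S ((u - P u) + P u) (v + 0) = S (P u) 0" and "S (P u) 0 = 0"
      using support_S P(2,3) that subspace_0[OF V] subspace_0[OF X]
      unfolding support_restricted_def by blast+
    then show ?thesis by simp
  qed

  \<comment> \<open>\<open>NX\<close> is unrelated to the norm of \<open>W\<close> a priori; pulled back to all of \<open>W\<close> it is a
      seminorm, hence continuous.\<close>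
  define p where "p u = NX (P u)" for u
  have p_nonneg: "0 \<le> p u" for u using norm_X P(2) by (simp add: norm_on_def p_def)
  have p_tri: "p (u + u') \<le> p u + p u'" for u u'
    using norm_X P(2) by (simp add: norm_on_def p_def linear_add[OF P(1)])
  have p_hom: "p (c *\<^sub>R u) = \<bar>c\<bar> * p u" for c u
    using norm_X P(2) by (simp add: norm_on_def p_def linear_scale[OF P(1)])
  have p_ker: "u \<in> V" if "p u = 0" for u
  proof -
    have "P u = 0" using that norm_X P(2) by (simp add: norm_on_def p_def)
    then show ?thesis using P(3)[of u] by simp
  qed
  obtain C where C: "C \<ge> 0" "\<And>u. p u \<le> C * norm u"
    using seminorm_le_norm_on_finite_span[of A p, OF A(1) p_tri p_hom p_nonneg] A(2) by auto
  have S_ge: "S u u \<ge> K * (p u)\<^sup>2" for u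
    using K(2)[OF P(2), of u] S_proj[of u u] by (simp add: p_def)

  have sol: "B (w \<sigma>) z + \<sigma> * S (w \<sigma>) z = l z" if "\<sigma> \<ge> 0" for \<sigma> z
    using w_solution[OF that] by (simp add: solves_on_def)
  have energy: "L * (norm (w \<sigma>))\<^sup>2 + \<sigma> * (K * (p (w \<sigma>))\<^sup>2) \<le> norm l * norm (w \<sigma>)" if "\<sigma> \<ge> 0" for \<sigma>
  proof -
    have "L * (norm (w \<sigma>))\<^sup>2 + \<sigma> * (K * (p (w \<sigma>))\<^sup>2) \<le> l (w \<sigma>)"
      using L(2)[of "w \<sigma>"] mult_left_mono[OF S_ge[of "w \<sigma>"] that] sol[OF that, of "w \<sigma>"] by linarith
    also have "\<dots> \<le> norm l * norm (w \<sigma>)" using norm_blinfun[of l "w \<sigma>"] by simp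
    finally show ?thesis .
  qed
  define M where "M = norm l / L"
  have w_bound: "norm (w \<sigma>) \<le> M" if "\<sigma> \<ge> 0" for \<sigma>
  proof (cases "w \<sigma> = 0")
    case False
    have "0 \<le> \<sigma> * (K * (p (w \<sigma>))\<^sup>2)" using that K(1) by simp
    then have "(L * norm (w \<sigma>)) * norm (w \<sigma>) \<le> norm l * norm (w \<sigma>)"
      using energy[OF that] by (simp add: power2_eq_square mult.assoc)
    then have "L * norm (w \<sigma>) \<le> norm l" using False by simp
    then show ?thesis using L(1) by (simp add: M_def field_simps)
  qed (use L(1) in \<open>simp add: M_def\<close>)
  have p_bound: "(p (w \<sigma>))\<^sup>2 \<le> (norm l * M / K) / \<sigma>" if "\<sigma> > 0" for \<sigma>
  proof -
    have "0 \<le> L * (norm (w \<sigma>))\<^sup>2" using L(1) by simp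
    then have "\<sigma> * (K * (p (w \<sigma>))\<^sup>2) \<le> norm l * M"
      using energy[of \<sigma>] mult_left_mono[OF w_bound[of \<sigma>] norm_ge_zero[of l]] that by linarith
    then show ?thesis using that K(1) by (simp add: field_simps)
  qed

  have limit_point: "u0 = vh"
    if s: "filterlim s at_top sequentially" "\<And>n. s n > 0" and u0: "(\<lambda>n. w (s n)) \<longlonglongrightarrow> u0"
    for s :: "nat \<Rightarrow> real" and u0
  proof -
    have "(\<lambda>n. (norm l * M / K) / s n) \<longlonglongrightarrow> 0"
      by (rule tendsto_divide_0[OF tendsto_const]) (use s(1) filterlim_at_top_imp_at_infinity in blast)
    then have "(\<lambda>n. (p (w (s n)))\<^sup>2) \<longlonglongrightarrow> 0"
      by (rule tendsto_sandwich[OF _ _ tendsto_const, rotated 2]) (use p_bound s(2) in auto)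
    then have p0: "(\<lambda>n. p (w (s n))) \<longlonglongrightarrow> 0"
      using tendsto_real_sqrt[of "\<lambda>n. (p (w (s n)))\<^sup>2" 0] p_nonneg by simp
    \<comment> \<open>Lower semicontinuity of \<open>p\<close> along the sequence is enough to get \<open>p u0 = 0\<close>.\<close>
    have "(\<lambda>n. p (w (s n)) + C * norm (u0 - w (s n))) \<longlonglongrightarrow> 0 + C * norm (u0 - u0)"
      by (intro tendsto_intros p0 u0)
    moreover have "p u0 \<le> p (w (s n)) + C * norm (u0 - w (s n))" for n
      using p_tri[of "w (s n)" "u0 - w (s n)"] C(2)[of "u0 - w (s n)"] by simp
    ultimately have "p u0 \<le> 0 + C * norm (u0 - u0)" by (intro LIMSEQ_le_const) auto
    then have "u0 \<in> V" using p_nonneg[of u0] by (intro p_ker) simp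
    moreover have "B u0 v = l v" if v: "v \<in> V" for v
    proof -
      have "(\<lambda>n. B (w (s n)) v) \<longlonglongrightarrow> B u0 v" using continuous_B[OF u0] v by blast
      moreover have "B (w (s n)) v = l v" for n
        using sol[of "s n" v] S_V[OF v] s(2)[of n] by simp
      ultimately show ?thesis by (simp add: LIMSEQ_const_iff)
    qed
    ultimately show "u0 = vh" by (intro vh_unique) (simp add: solves_on_def)
  qed

  have "(w \<longlongrightarrow> vh) at_top"
  proof (rule ccontr)
    assume "\<not> (w \<longlongrightarrow> vh) at_top"
    then obtain e where e: "e > 0" "\<not> eventually (\<lambda>\<sigma>. dist (w \<sigma>) vh < e) at_top"
      by (auto simp: tendsto_iff)
    then have "\<forall>n::nat. \<exists>\<sigma>\<ge>real (Suc n). \<not> dist (w \<sigma>) vh < e"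
      by (auto simp: eventually_at_top_linorder)
    then obtain s where s: "\<And>n::nat. s n \<ge> real (Suc n)" "\<And>n. \<not> dist (w (s n)) vh < e" by metis
    have s_pos: "s n > 0" for n using s(1)[of n] by simp
    have s_top: "filterlim s at_top sequentially"
      by (rule filterlim_at_top_mono[OF filterlim_real_sequentially])
        (use order_trans[OF _ s(1)] in \<open>auto intro!: always_eventually\<close>)
    have "norm (w (s n)) \<le> M" for n using w_bound s_pos less_imp_le by blast
    then have "bounded (range (\<lambda>n. w (s n)))" by (auto simp: bounded_iff)
    then obtain u0 r where r: "strict_mono (r::nat \<Rightarrow> nat)" "((\<lambda>n. w (s n)) \<circ> r) \<longlonglongrightarrow> u0"
      using bounded_seq_in_finite_span[OF A(1), of "\<lambda>n. w (s n)"] A(2) by auto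
    have "filterlim (\<lambda>n. s (r n)) at_top sequentially"
      using s_top filterlim_subseq[OF r(1)] by (rule filterlim_compose)
    then have "u0 = vh" using r(2) s_pos by (intro limit_point[of "\<lambda>n. s (r n)"]) (simp_all add: o_def)
    then have "eventually (\<lambda>n. dist (w (s (r n))) vh < e) sequentially"
      using r(2) e(1) by (simp add: tendsto_iff o_def)
    then show False using s(2) by simp
  qed
  then show ?thesis using LIM_zero by blast
qed

end
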